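(* Let $G$ be a finite group and let $U$ be a finite group isomorphic to a subquotient of $G$. (i) As an $\mathrm{Aut}(U)$-set, $\mathcal{M}_G(U)/G$ is the disjoint union of transitive $\mathrm{Aut}(U)$-sets $$\mathcal{M}_G^{P,K}(U)/G := \{[\theta]_G : \theta\in \mathcal{M}_G^{P,K}(U)\},$$ one for each $G$-class of sections $[P,K]_G\in \mathcal{Q}_G(U)/G$. (ii) Let $\theta\colon P/K\to U$ be a $U$-morphism of $G$. Then $$\mathcal{M}_G^{P,K}(U)/G = \{[\theta\alpha]_G : \alpha\in D_\theta\},$$ where $D_\theta$ is a transversal of the right cosets $A_\theta\alpha$ of $A_\theta$ in $\mathrm{Aut}(U)$.
   Context: Homomorphisms act from the right and are composed accordingly: $a^{\phi\psi}=(a^\phi)^\psi$. A section of $G$ is a pair $(P,K)$ of subgroups with $K\trianglelefteq P$. $\mathcal{Q}_G(U)$ is the set of sections $(P,K)$ of $G$ with $P/K\cong U$; $G$ acts on it by $(P,K)^g=(P^g,K^g)$, with classes $[P,K]_G$, and $\mathcal{Q}_G(U)/G$ is the set of these classes. A $U$-morphism of $G$ is an isomorphism $\theta\colon P/K\to U$ with $(P,K)\in\mathcal{Q}_G(U)$; $\mathcal{M}_G(U)$ is the set of all $U$-morphisms of $G$, and $\mathcal{M}_G^{P,K}(U)$ the set of those with domain $P/K$. $G$ acts on $\mathcal{M}_G(U)$ by $\theta^a=\gamma_a^{-1}\theta$, where $\gamma_a\colon P/K\to P^a/K^a$ is the conjugation map induced by $a\in G$. $[\theta]_G=\{\theta^a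 : a\in G\}$ is the (full) $G$-orbit, and $\mathcal{M}_G(U)/G$ is the set of all these orbits. $\mathrm{Aut}(U)$ acts on $\mathcal{M}_G(U)$ by $(\theta,\alpha)\mapsto\theta\alpha$; this commutes with the action of $G$ and induces the action $([\theta]_G,\alpha)\mapsto[\theta\alpha]_G$ on $\mathcal{M}_G(U)/G$. For $\theta\colon P/K\to U$, $A_\theta\leq\mathrm{Aut}(U)$ is the group of all automorphisms $\theta^{-1}\gamma_n\theta$ of $U$, where $n\in N_G(P)\cap N_G(K)$ and $\gamma_n$ is the automorphism of $P/K$ induced by conjugation by $n$. *)

theory Defs
  imports "HOL-Algebra.Algebra" "HOL-Library.Disjoint_Sets"
begin

text \<open>
  Homomorphisms are composed from left to right and all actions are right actions.  The library
  composes automorphisms from right to left and only has left actions, so the automorphism group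
  is the opposite of the library's, and a right action of \<open>H\<close> is a left action of the
  opposite group of \<open>H\<close>.
\<close>

definition opp_group :: "('a, 'm) monoid_scheme \<Rightarrow> ('a, 'm) monoid_scheme" where
  "opp_group H = H\<lparr>mult := \<lambda>x y. y \<otimes>\<^bsub>H\<^esub> x\<rparr>"

definition Aut :: "('b, 'n) monoid_scheme \<Rightarrow> ('b \<Rightarrow> 'b) monoid" where
  "Aut U = opp_group (AutoGroup U)"

definition right_action ::
    "('h, 'm) monoid_scheme \<Rightarrow> 'x set \<Rightarrow> ('h \<Rightarrow> 'x \<Rightarrow> 'x) \<Rightarrow> bool" where
  "right_action H E \<phi> \<longleftrightarrow> group_action (opp_group H) E \<phi>"

definition transitive_right_action ::
    "('h, 'm) monoid_scheme \<Rightarrow> 'x set \<Rightarrow> ('h \<Rightarrow> 'x \<Rightarrow> 'x) \<Rightarrow> bool" where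
  "transitive_right_action H E \<phi> \<longleftrightarrow> transitive_action (opp_group H) E \<phi> \<and> E \<noteq> {}"

definition quot :: "('a, 'm) monoid_scheme \<Rightarrow> 'a set \<Rightarrow> 'a set \<Rightarrow> 'a set monoid" where
  "quot G P K = (G\<lparr>carrier := P\<rparr>) Mod K"

definition sections :: "('a, 'm) monoid_scheme \<Rightarrow> ('a set \<times> 'a set) set" where
  "sections G = {(P, K). subgroup P G \<and> K \<lhd> (G\<lparr>carrier := P\<rparr>)}"

definition iso_sections ::
    "('a, 'm) monoid_scheme \<Rightarrow> ('b, 'n) monoid_scheme \<Rightarrow> ('a set \<times> 'a set) set" where
  "iso_sections G U = {(P, K). (P, K) \<in> sections G \<and> quot G P K \<cong> U}"

text \<open>
  \<open>conj_set G a S\<close> is \<open>S\<^sup>a = a\<^sup>-\<^sup>1 S a\<close>; on the cosets of \<open>K\<close> in \<open>P\<close> it is the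
  map \<open>\<gamma>\<^sub>a\<close> from \<open>P/K\<close> to \<open>P\<^sup>a/K\<^sup>a\<close>.
\<close>

definition conj_set :: "('a, 'm) monoid_scheme \<Rightarrow> 'a \<Rightarrow> 'a set \<Rightarrow> 'a set" where
  "conj_set G a S = (inv\<^bsub>G\<^esub> a <#\<^bsub>G\<^esub> S) #>\<^bsub>G\<^esub> a"

definition section_conj ::
    "('a, 'm) monoid_scheme \<Rightarrow> 'a \<Rightarrow> 'a set \<times> 'a set \<Rightarrow> 'a set \<times> 'a set" where
  "section_conj G a = (\<lambda>(P, K). (conj_set G a P, conj_set G a K))"

definition section_class ::
    "('a, 'm) monoid_scheme \<Rightarrow> 'a set \<times> 'a set \<Rightarrow> ('a set \<times> 'a set) set" where
  "section_class G = orbit G (section_conj G)"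

definition section_classes ::
    "('a, 'm) monoid_scheme \<Rightarrow> ('b, 'n) monoid_scheme \<Rightarrow> ('a set \<times> 'a set) set set" where
  "section_classes G U = orbits G (iso_sections G U) (section_conj G)"

text \<open>
  A \<open>U\<close>-morphism carries its section, since an extensional function alone need not determine its
  domain (\<^const>\<open>undefined\<close> may be an element of \<open>U\<close>).
\<close>

type_synonym ('a, 'b) umor = "'a set \<times> 'a set \<times> ('a set \<Rightarrow> 'b)"

definition umors ::
    "('a, 'm) monoid_scheme \<Rightarrow> ('b, 'n) monoid_scheme \<Rightarrow> ('a, 'b) umor set" where
  "umors G U = {(P, K, \<theta>). (P, K) \<in> iso_sections G U \<and>
     \<theta> \<in> iso (quot G P K) U \<and> \<theta> \<in> extensional (carrier (quot G P K))}"

definition umors_at ::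
    "('a, 'm) monoid_scheme \<Rightarrow> ('b, 'n) monoid_scheme \<Rightarrow> 'a set \<Rightarrow> 'a set \<Rightarrow> ('a, 'b) umor set" where
  "umors_at G U P K = {(P', K', \<theta>) \<in> umors G U. P' = P \<and> K' = K}"

text \<open>The action \<open>\<theta>\<^sup>a = \<gamma>\<^sub>a\<^sup>-\<^sup>1 \<theta>\<close> of \<open>G\<close>: first \<open>\<gamma>\<^sub>a\<^sup>-\<^sup>1\<close>, then \<open>\<theta>\<close>.\<close>

definition umor_conj ::
    "('a, 'm) monoid_scheme \<Rightarrow> 'a \<Rightarrow> ('a, 'b) umor \<Rightarrow> ('a, 'b) umor" where
  "umor_conj G a = (\<lambda>(P, K, \<theta>).
     (conj_set G a P, conj_set G a K,
      compose (carrier (quot G (conj_set G a P) (conj_set G a K)))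
        \<theta> (inv_into (carrier (quot G P K)) (conj_set G a))))"

definition umor_class ::
    "('a, 'm) monoid_scheme \<Rightarrow> ('a, 'b) umor \<Rightarrow> ('a, 'b) umor set" where
  "umor_class G = orbit G (umor_conj G)"

definition umor_classes ::
    "('a, 'm) monoid_scheme \<Rightarrow> ('b, 'n) monoid_scheme \<Rightarrow> ('a, 'b) umor set set" where
  "umor_classes G U = orbits G (umors G U) (umor_conj G)"

definition umor_classes_at ::
    "('a, 'm) monoid_scheme \<Rightarrow> ('b, 'n) monoid_scheme \<Rightarrow> 'a set \<Rightarrow> 'a set \<Rightarrow>
     ('a, 'b) umor set set" where
  "umor_classes_at G U P K = {umor_class G m | m. m \<in> umors_at G U P K}"

text \<open>The right multiplication \<open>\<theta> \<mapsto> \<theta>\<alpha>\<close>: first \<open>\<theta>\<close>, then \<open>\<alpha>\<close>.\<close>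

definition umor_aut ::
    "('a, 'm) monoid_scheme \<Rightarrow> ('b \<Rightarrow> 'b) \<Rightarrow> ('a, 'b) umor \<Rightarrow> ('a, 'b) umor" where
  "umor_aut G \<alpha> = (\<lambda>(P, K, \<theta>). (P, K, compose (carrier (quot G P K)) \<alpha> \<theta>))"

text \<open>
  The induced operation \<open>([\<theta>], \<alpha>) \<mapsto> [\<theta>\<alpha>]\<close> on a set \<open>E\<close> of \<open>G\<close>-orbits.  The class
  \<open>[\<theta>\<alpha>]\<close> does not depend on the representative \<open>\<theta>\<close> of the orbit \<open>C\<close>, so the union
  is over a single set.
\<close>

definition class_aut ::
    "('a, 'm) monoid_scheme \<Rightarrow> ('a, 'b) umor set set \<Rightarrow> ('b \<Rightarrow> 'b) \<Rightarrow>
     ('a, 'b) umor set \<Rightarrow> ('a, 'b) umor set" where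
  "class_aut G E \<alpha> = (\<lambda>C\<in>E. \<Union>m\<in>C. umor_class G (umor_aut G \<alpha> m))"

text \<open>The group \<open>A\<^sub>\<theta>\<close> of the automorphisms \<open>\<theta>\<^sup>-\<^sup>1 \<gamma>\<^sub>n \<theta>\<close>, as a set.\<close>

definition A_umor ::
    "('a, 'm) monoid_scheme \<Rightarrow> ('b, 'n) monoid_scheme \<Rightarrow> ('a, 'b) umor \<Rightarrow> ('b \<Rightarrow> 'b) set" where
  "A_umor G U = (\<lambda>(P, K, \<theta>).
     {\<lambda>u\<in>carrier U. \<theta> (conj_set G n (inv_into (carrier (quot G P K)) \<theta> u)) | n.
        n \<in> normalizer G P \<inter> normalizer G K})"

definition right_transversal :: "('h, 'm) monoid_scheme \<Rightarrow> 'h set \<Rightarrow> 'h set \<Rightarrow> bool" where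
  "right_transversal H A D \<longleftrightarrow>
     D \<subseteq> carrier H \<and> (\<forall>C \<in> rcosets\<^bsub>H\<^esub> A. \<exists>!d. d \<in> D \<inter> C)"

end

theory Submission
  imports Defs
begin

text \<open>
  Conjugation by \<open>a\<close> is an isomorphism \<open>P/K \<rightarrow> P\<^sup>a/K\<^sup>a\<close>, so every \<open>U\<close>-morphism on a section
  conjugate to \<open>(P, K)\<close> is conjugate to one on \<open>(P, K)\<close> itself; this makes the set of classes
  at \<open>(P, K)\<close> depend only on the class of \<open>(P, K)\<close>.  Two \<open>U\<close>-morphisms \<open>\<theta>\<close>, \<open>\<theta>'\<close> on the same
  section differ by the automorphism \<open>\<theta>\<^sup>-\<^sup>1\<theta>'\<close>, which gives transitivity, and multiplying \<open>\<theta>\<close> on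
  the right by \<open>\<theta>\<^sup>-\<^sup>1\<gamma>\<^sub>n\<theta> \<in> A\<^sub>\<theta>\<close> amounts to conjugating it by \<open>n\<^sup>-\<^sup>1\<close>, so that a transversal of
  the cosets of \<open>A\<^sub>\<theta>\<close> suffices.
\<close>

section \<open>Actions\<close>

lemma opp_group_Aut [simp]: "opp_group (Aut U) = AutoGroup U"
  by (simp add: opp_group_def Aut_def)

lemma carrier_AutoGroup [simp]: "carrier (AutoGroup U) = auto U"
  by (simp add: AutoGroup_def)

text \<open>The product of \<open>BijGroup\<close> is a function restricted to bijections in both
  arguments, hence the two membership hypotheses.\<close>

lemma mult_AutoGroup:
  assumes "\<alpha> \<in> auto U" "\<beta> \<in> auto U"
  shows "\<alpha> \<otimes>\<^bsub>AutoGroup U\<^esub> \<beta> = compose (carrier U) \<alpha> \<beta>"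
  using assms by (simp add: AutoGroup_def BijGroup_def auto_def)

lemma one_AutoGroup: "\<one>\<^bsub>AutoGroup U\<^esub> = (\<lambda>u\<in>carrier U. u)"
  by (simp add: AutoGroup_def BijGroup_def)

text \<open>Composites of isomorphisms need not be extensional, while members of
  \<open>umors\<close> and \<open>auto\<close> must be. Cutting down to the carrier preserves the
  homomorphism law because a group carrier is closed under products.\<close>

lemma restrict_iso:
  assumes "group H" "f \<in> iso H U"
  shows "restrict f (carrier H) \<in> iso H U"
  using assms by (auto simp: iso_def hom_def group.is_monoid[THEN monoid.m_closed])

text \<open>Bijectivity of each \<phi> h comes for free: \<phi> of the inverse of h undoes it.
  Extensionality has to be supplied because \<open>Bij E\<close> contains extensional functions
  only.\<close>

lemma group_actionI:
  assumes "group H"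
    and ext: "\<And>h. h \<in> carrier H \<Longrightarrow> \<phi> h \<in> extensional E"
    and closed: "\<And>h x. h \<in> carrier H \<Longrightarrow> x \<in> E \<Longrightarrow> \<phi> h x \<in> E"
    and one: "\<And>x. x \<in> E \<Longrightarrow> \<phi> \<one>\<^bsub>H\<^esub> x = x"
    and mult: "\<And>g h x. g \<in> carrier H \<Longrightarrow> h \<in> carrier H \<Longrightarrow> x \<in> E \<Longrightarrow>
      \<phi> (g \<otimes>\<^bsub>H\<^esub> h) x = \<phi> g (\<phi> h x)"
  shows "group_action H E \<phi>"
proof -
  interpret H: group H by fact
  have "bij_betw (\<phi> h) E E" if h: "h \<in> carrier H" for h
  proof (rule bij_betw_byWitness[where f' = "\<phi> (inv\<^bsub>H\<^esub> h)"])
    show "\<forall>x\<in>E. \<phi> (inv\<^bsub>H\<^esub> h) (\<phi> h x) = x"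
      using h by (simp add: mult[symmetric] one)
    show "\<forall>x\<in>E. \<phi> h (\<phi> (inv\<^bsub>H\<^esub> h) x) = x"
      using h by (simp add: mult[symmetric] one)
  qed (use h closed in auto)
  then have Bij: "\<phi> h \<in> Bij E" if "h \<in> carrier H" for h
    using that ext by (simp add: Bij_def)
  have "\<phi> (g \<otimes>\<^bsub>H\<^esub> h) = compose E (\<phi> g) (\<phi> h)" if "g \<in> carrier H" "h \<in> carrier H" for g h
  proof (rule extensionalityI[where A = E])
    show "\<phi> (g \<otimes>\<^bsub>H\<^esub> h) \<in> extensional E"
      using that by (simp add: ext)
  qed (simp_all add: that mult compose_def)
  then have "\<phi> \<in> hom H (BijGroup E)"
    using Bij by (auto simp: hom_def BijGroup_def)
  then show ?thesis
    by (simp add: group_action_def group_hom_def group_hom_axioms_def group_BijGroup \<open>group H\<close>)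
qed

text \<open>Each g equals a(a^-1 g), so left translation by a merely reindexes the orbit. The right
  action law is required at x alone, so the lemma applies to operations such as
  \<open>umor_conj\<close> that are not restricted to a set.\<close>

lemma (in group) orbit_right_action_eq:
  assumes "a \<in> carrier G"
    and mult: "\<And>b. b \<in> carrier G \<Longrightarrow> \<phi> (a \<otimes> b) x = \<phi> b (\<phi> a x)"
  shows "orbit G \<phi> (\<phi> a x) = orbit G \<phi> x"
proof -
  have "\<exists>b\<in>carrier G. \<phi> g x = \<phi> b (\<phi> a x)" if "g \<in> carrier G" for g
  proof
    show "\<phi> g x = \<phi> (inv a \<otimes> g) (\<phi> a x)"
      using assms(1) that by (simp add: mult[symmetric] m_assoc[symmetric])
  qed (use assms(1) that in simp)
  moreover have "\<exists>g\<in>carrier G. \<phi> b (\<phi> a x) = \<phi> g x" if "b \<in> carrier G" for b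
    using assms that by (metis m_closed)
  ultimately show ?thesis
    unfolding orbit_def by blast
qed

section \<open>Conjugation of sections\<close>

lemma carrier_quot: "carrier (quot G P K) = (\<lambda>x. K #>\<^bsub>G\<^esub> x) ` P"
  by (simp add: quot_def carrier_FactGroup)

lemma mult_quot: "monoid.mult (quot G P K) = set_mult G"
  by (simp add: quot_def set_mult_def fun_eq_iff)

text \<open>This is the family that witnesses the decomposition. The union avoids choosing a
  representative of c: on a class of sections all its members turn out to be equal.\<close>

definition umor_classes_over ::
    "('a, 'm) monoid_scheme \<Rightarrow> ('b, 'n) monoid_scheme \<Rightarrow> ('a set \<times> 'a set) set \<Rightarrow>
     ('a, 'b) umor set set" where
  "umor_classes_over G U c = (\<Union>(P, K)\<in>c. umor_classes_at G U P K)"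

context group
begin

lemma conj_set_eq_image: "conj_set G a S = (\<lambda>x. inv a \<otimes> x \<otimes> a) ` S"
  by (auto simp: conj_set_def l_coset_def r_coset_def)

lemma conj_set_one: "S \<subseteq> carrier G \<Longrightarrow> conj_set G \<one> S = S"
  by (force simp: conj_set_eq_image)

lemma conj_set_mult:
  assumes "a \<in> carrier G" "b \<in> carrier G" "S \<subseteq> carrier G"
  shows "conj_set G (a \<otimes> b) S = conj_set G b (conj_set G a S)"
  unfolding conj_set_eq_image image_image
  by (rule image_cong) (use assms in \<open>auto simp: inv_mult_group m_assoc subset_iff\<close>)

lemma conj_set_inv:
  assumes "a \<in> carrier G" "S \<subseteq> carrier G"
  shows "conj_set G (inv a) (conj_set G a S) = S" "conj_set G a (conj_set G (inv a) S) = S"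
  using assms by (simp_all add: conj_set_mult[symmetric] conj_set_one)

lemma conj_hom:
  assumes "a \<in> carrier G" "x \<in> carrier G" "y \<in> carrier G"
  shows "inv a \<otimes> (x \<otimes> y) \<otimes> a = (inv a \<otimes> x \<otimes> a) \<otimes> (inv a \<otimes> y \<otimes> a)"
proof -
  have "a \<otimes> (inv a \<otimes> (y \<otimes> a)) = y \<otimes> a"
    using assms by (simp add: m_assoc[symmetric])
  then show ?thesis
    using assms by (simp add: m_assoc)
qed

lemma conj_set_set_mult:
  assumes "a \<in> carrier G" "S \<subseteq> carrier G" "T \<subseteq> carrier G"
  shows "conj_set G a (S <#> T) = conj_set G a S <#> conj_set G a T"
proof -
  have eq: "inv a \<otimes> (x \<otimes> y) \<otimes> a = (inv a \<otimes> x \<otimes> a) \<otimes> (inv a \<otimes> y \<otimes> a)"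
    if "x \<in> S" "y \<in> T" for x y
    using conj_hom assms that by blast
  show ?thesis
    unfolding conj_set_eq_image set_mult_def
    by (auto simp: eq image_iff) (metis eq)+
qed

text \<open>A coset is the set product of K with a singleton, so this is a case of conjugation
  respecting set products.\<close>

lemma conj_set_r_coset:
  assumes "a \<in> carrier G" "K \<subseteq> carrier G" "x \<in> carrier G"
  shows "conj_set G a (K #> x) = conj_set G a K #> (inv a \<otimes> x \<otimes> a)"
  using conj_set_set_mult[OF assms(1,2), of "{x}"] assms(3)
  by (simp add: r_coset_eq_set_mult conj_set_eq_image)

lemma conj_set_subgroup:
  assumes "a \<in> carrier G" "subgroup H G"
  shows "subgroup (conj_set G a H) G"
proof -
  have "(\<lambda>x. inv a \<otimes> x \<otimes> a) \<in> hom G G"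
    using assms by (auto simp: hom_def conj_hom)
  then have "group_hom G G (\<lambda>x. inv a \<otimes> x \<otimes> a)"
    by (simp add: group_hom_def group_hom_axioms_def)
  then show ?thesis
    unfolding conj_set_eq_image using assms(2) by (rule group_hom.subgroup_img_is_subgroup)
qed

text \<open>Normality is moved from the group on P to a condition in G itself, where conjugation by
  elements outside P makes sense.\<close>

lemma sections_iff:
  "(P, K) \<in> sections G \<longleftrightarrow>
     subgroup P G \<and> subgroup K G \<and> K \<subseteq> P \<and> (\<forall>x\<in>P. \<forall>h\<in>K. x \<otimes> h \<otimes> inv x \<in> K)"
proof (cases "subgroup P G")
  case True
  have "group (G\<lparr>carrier := P\<rparr>)"
    using True by (rule subgroup.subgroup_is_group) (rule is_group)
  note normal_iff = group.normal_inv_iff[OF this]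
  have "subgroup K (G\<lparr>carrier := P\<rparr>) \<longleftrightarrow> subgroup K G \<and> K \<subseteq> P"
    using incl_subgroup[OF True] subgroup_incl[OF _ True]
      subgroup.subset[of K "G\<lparr>carrier := P\<rparr>"] by auto
  moreover have "x \<otimes> h \<otimes> inv\<^bsub>G\<lparr>carrier := P\<rparr>\<^esub> x = x \<otimes> h \<otimes> inv x" if "x \<in> P" for x h
    using True that by (simp add: m_inv_consistent)
  ultimately show ?thesis
    using True by (simp add: sections_def normal_iff)
qed (simp add: sections_def)

lemma sections_subset:
  assumes "(P, K) \<in> sections G"
  shows "P \<subseteq> carrier G" "K \<subseteq> carrier G"
  using assms by (auto simp: sections_iff dest: subgroup.subset)

lemma quot_subset:
  assumes "(P, K) \<in> sections G" "C \<in> carrier (quot G P K)"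
  shows "C \<subseteq> carrier G"
  using assms(2) sections_subset[OF assms(1)]
  by (auto simp: carrier_quot dest: r_coset_subset_G[THEN subsetD, rotated 2])

lemma conj_set_sections:
  assumes "a \<in> carrier G" "(P, K) \<in> sections G"
  shows "(conj_set G a P, conj_set G a K) \<in> sections G"
proof -
  note PK = assms(2)[unfolded sections_iff] sections_subset[OF assms(2)]
  have "(inv a \<otimes> x \<otimes> a) \<otimes> (inv a \<otimes> h \<otimes> a) \<otimes> inv (inv a \<otimes> x \<otimes> a) \<in> conj_set G a K"
    if xh: "x \<in> P" "h \<in> K" for x h
  proof -
    have G: "x \<in> carrier G" "h \<in> carrier G"
      using PK xh by auto
    have "inv (inv a \<otimes> x \<otimes> a) = inv a \<otimes> inv x \<otimes> a"
      using G assms(1) by (simp add: inv_mult_group m_assoc)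
    then have "(inv a \<otimes> x \<otimes> a) \<otimes> (inv a \<otimes> h \<otimes> a) \<otimes> inv (inv a \<otimes> x \<otimes> a)
        = inv a \<otimes> (x \<otimes> h \<otimes> inv x) \<otimes> a"
      using G assms(1) by (simp add: conj_hom)
    moreover have "x \<otimes> h \<otimes> inv x \<in> K"
      using PK xh by blast
    ultimately show ?thesis
      by (simp add: conj_set_eq_image)
  qed
  then show ?thesis
    using PK assms(1) unfolding sections_iff
    by (auto simp: conj_set_subgroup) (auto simp: conj_set_eq_image)
qed

lemma carrier_quot_conj:
  assumes "a \<in> carrier G" "(P, K) \<in> sections G"
  shows "carrier (quot G (conj_set G a P) (conj_set G a K)) = conj_set G a ` carrier (quot G P K)"
proof -
  have "conj_set G a K #> (inv a \<otimes> x \<otimes> a) = conj_set G a (K #> x)" if "x \<in> P" for x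
    using assms that sections_subset[OF assms(2)] by (subst conj_set_r_coset) auto
  then show ?thesis
    by (simp add: carrier_quot image_image conj_set_eq_image[of a P] cong: image_cong)
qed

lemma conj_set_iso:
  assumes "a \<in> carrier G" "(P, K) \<in> sections G"
  shows "conj_set G a \<in> iso (quot G P K) (quot G (conj_set G a P) (conj_set G a K))"
proof -
  note C = quot_subset[OF assms(2)]
  \<comment> \<open>Conjugation by a^-1 is a left inverse; its law needs every coset to be a subset
    of G.\<close>
  have "inj_on (conj_set G a) (carrier (quot G P K))"
    by (rule inj_on_inverseI[where g = "conj_set G (inv a)"]) (simp add: C conj_set_inv assms(1))
  then show ?thesis
    using assms by (auto simp: iso_def hom_def bij_betw_def carrier_quot_conj mult_quot
        conj_set_set_mult C)
qed

text \<open>The previous isomorphism is applied to the conjugate section and a^-1, which leads back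
  to P and K.\<close>

lemma conj_set_inv_iso:
  assumes "a \<in> carrier G" "(P, K) \<in> sections G"
  shows "conj_set G (inv a) \<in> iso (quot G (conj_set G a P) (conj_set G a K)) (quot G P K)"
  using conj_set_iso[OF _ conj_set_sections[OF assms], of "inv a"] assms
  by (simp add: conj_set_inv sections_subset[OF assms(2)])

lemma section_conj_mult:
  assumes "a \<in> carrier G" "b \<in> carrier G" "(P, K) \<in> sections G"
  shows "section_conj G (a \<otimes> b) (P, K) = section_conj G b (section_conj G a (P, K))"
  using assms sections_subset[OF assms(3)] by (simp add: section_conj_def conj_set_mult)

lemma section_class_conj:
  assumes "a \<in> carrier G" "(P, K) \<in> sections G"
  shows "section_class G (conj_set G a P, conj_set G a K) = section_class G (P, K)"
proof -
  have "section_class G (section_conj G a (P, K)) = section_class G (P, K)"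
    unfolding section_class_def using assms section_conj_mult
    by (intro orbit_right_action_eq) auto
  then show ?thesis
    by (simp add: section_conj_def)
qed

section \<open>Conjugation of morphisms\<close>

lemma group_quot: "(P, K) \<in> sections G \<Longrightarrow> group (quot G P K)"
  by (auto simp: sections_def quot_def intro: normal.factorgroup_is_group)

text \<open>The map \<theta> itself witnesses that P/K is isomorphic to U, so being a section
  suffices for the pair (P, K).\<close>

lemma umors_iff:
  "(P, K, \<theta>) \<in> umors G U \<longleftrightarrow> (P, K) \<in> sections G \<and> \<theta> \<in> iso (quot G P K) U \<and>
     \<theta> \<in> extensional (carrier (quot G P K))"
  by (auto simp: umors_def iso_sections_def is_iso_def)

text \<open>On the conjugate quotient the choice-based inverse of \<gamma>_a is conjugation by a^-1.
  This explicit form is the one to calculate with.\<close>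

lemma umor_conj_eq:
  assumes "a \<in> carrier G" "(P, K) \<in> sections G"
  shows "umor_conj G a (P, K, \<theta>) = (conj_set G a P, conj_set G a K,
    \<lambda>C\<in>carrier (quot G (conj_set G a P) (conj_set G a K)). \<theta> (conj_set G (inv a) C))"
proof -
  have "inv_into (carrier (quot G P K)) (conj_set G a) C = conj_set G (inv a) C"
    if C: "C \<in> carrier (quot G (conj_set G a P) (conj_set G a K))" for C
  proof -
    obtain Y where Y: "Y \<in> carrier (quot G P K)" "C = conj_set G a Y"
      using C assms by (auto simp: carrier_quot_conj)
    moreover have "inj_on (conj_set G a) (carrier (quot G P K))"
      using conj_set_iso[OF assms] by (simp add: iso_def bij_betw_def)
    ultimately show ?thesis
      using assms quot_subset by (simp add: inv_into_f_f conj_set_inv)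
  qed
  then show ?thesis
    by (simp add: umor_conj_def compose_def restrict_def fun_eq_iff)
qed

lemma umor_conj_closed:
  assumes "a \<in> carrier G" "m \<in> umors G U"
  shows "umor_conj G a m \<in> umors G U"
proof (cases m)
  case (fields P K \<theta>)
  note m = assms(2)[unfolded fields umors_iff]
  have "\<theta> \<circ> conj_set G (inv a) \<in> iso (quot G (conj_set G a P) (conj_set G a K)) U"
    using m assms(1) by (intro iso_set_trans[OF conj_set_inv_iso]) auto
  then have "restrict (\<theta> \<circ> conj_set G (inv a)) (carrier (quot G (conj_set G a P) (conj_set G a K)))
      \<in> iso (quot G (conj_set G a P) (conj_set G a K)) U"
    using m assms(1) by (intro restrict_iso group_quot conj_set_sections) auto
  then show ?thesis
    using m assms(1) by (simp add: fields umor_conj_eq umors_iff conj_set_sections o_def)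
qed

lemma umor_conj_one:
  assumes "m \<in> umors G U"
  shows "umor_conj G \<one> m = m"
proof (cases m)
  case (fields P K \<theta>)
  note m = assms[unfolded fields umors_iff]
  have "(\<lambda>C\<in>carrier (quot G P K). \<theta> (conj_set G \<one> C)) = restrict \<theta> (carrier (quot G P K))"
    using m by (intro restrict_ext) (simp add: conj_set_one quot_subset[of P K])
  then show ?thesis
    using m by (simp add: fields umor_conj_eq conj_set_one sections_subset[of P K] extensional_restrict)
qed

text \<open>The inverse of \<gamma>_(ab) is first the inverse of \<gamma>_b and then that of
  \<gamma>_a, so the action is a right action.\<close>

lemma umor_conj_mult:
  assumes "a \<in> carrier G" "b \<in> carrier G" "m \<in> umors G U"
  shows "umor_conj G (a \<otimes> b) m = umor_conj G b (umor_conj G a m)"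
proof (cases m)
  case (fields P K \<theta>)
  note m = assms(3)[unfolded fields umors_iff]
  define P' K' where "P' = conj_set G a P" and "K' = conj_set G a K"
  have sec: "(P', K') \<in> sections G"
    using m assms(1) by (simp add: P'_def K'_def conj_set_sections)
  have eq: "conj_set G (a \<otimes> b) P = conj_set G b P'" "conj_set G (a \<otimes> b) K = conj_set G b K'"
    using m assms by (simp_all add: P'_def K'_def conj_set_mult sections_subset[of P K])
  \<comment> \<open>The inner function is restricted, so it must be checked that conjugation by b^-1
    sends C into its domain.\<close>
  have "\<theta> (conj_set G (inv (a \<otimes> b)) C) =
      (\<lambda>Y\<in>carrier (quot G P' K'). \<theta> (conj_set G (inv a) Y)) (conj_set G (inv b) C)"
    if C: "C \<in> carrier (quot G (conj_set G b P') (conj_set G b K'))" for C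
  proof -
    have "conj_set G (inv b) C \<in> carrier (quot G P' K')"
      using conj_set_inv_iso[OF assms(2) sec] C by (auto simp: iso_def hom_def)
    moreover have "C \<subseteq> carrier G"
      using quot_subset[OF conj_set_sections[OF assms(2) sec] C] .
    ultimately show ?thesis
      using assms by (simp add: inv_mult_group conj_set_mult)
  qed
  then have "(\<lambda>C\<in>carrier (quot G (conj_set G b P') (conj_set G b K')).
        \<theta> (conj_set G (inv (a \<otimes> b)) C)) =
      (\<lambda>C\<in>carrier (quot G (conj_set G b P') (conj_set G b K')).
        (\<lambda>Y\<in>carrier (quot G P' K'). \<theta> (conj_set G (inv a) Y)) (conj_set G (inv b) C))"
    by (rule restrict_ext)
  moreover have "umor_conj G (a \<otimes> b) m = (conj_set G b P', conj_set G b K',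
      \<lambda>C\<in>carrier (quot G (conj_set G b P') (conj_set G b K')). \<theta> (conj_set G (inv (a \<otimes> b)) C))"
    using m assms by (simp add: fields umor_conj_eq eq)
  moreover have "umor_conj G a m =
      (P', K', \<lambda>Y\<in>carrier (quot G P' K'). \<theta> (conj_set G (inv a) Y))"
    using m assms(1) by (simp add: fields umor_conj_eq P'_def K'_def)
  ultimately show ?thesis
    using sec assms(2) by (simp only: umor_conj_eq)
qed

lemma umor_class_conj:
  assumes "a \<in> carrier G" "m \<in> umors G U"
  shows "umor_class G (umor_conj G a m) = umor_class G m"
  unfolding umor_class_def
  by (rule orbit_right_action_eq[where \<phi> = "umor_conj G", OF assms(1) umor_conj_mult])
    (use assms in auto)

lemma umor_class_eqE:
  assumes "umor_class G m = umor_class G m'" "m' \<in> umors G U"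
  obtains a where "a \<in> carrier G" "m' = umor_conj G a m"
proof -
  have "m' \<in> umor_class G m'"
    unfolding umor_class_def orbit_def using umor_conj_one[OF assms(2)] by force
  then show ?thesis
    using assms(1) that by (auto simp: umor_class_def orbit_def)
qed

lemma umor_classes_at_conj:
  assumes "a \<in> carrier G" "(P, K) \<in> sections G"
  shows "umor_classes_at G U (conj_set G a P) (conj_set G a K) = umor_classes_at G U P K"
proof -
  \<comment> \<open>One inclusion for arbitrary sections is enough: the reverse one follows by
    applying it to the conjugate section with a^-1.\<close>
  have le: "umor_classes_at G U P' K' \<subseteq>
      umor_classes_at G U (conj_set G b P') (conj_set G b K')"
    if "b \<in> carrier G" "(P', K') \<in> sections G" for b P' K'
  proof
    fix C assume "C \<in> umor_classes_at G U P' K'"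
    then obtain \<theta> where \<theta>: "C = umor_class G (P', K', \<theta>)" "(P', K', \<theta>) \<in> umors G U"
      by (auto simp: umor_classes_at_def umors_at_def)
    moreover have "umor_conj G b (P', K', \<theta>) \<in> umors_at G U (conj_set G b P') (conj_set G b K')"
      using umor_conj_closed[OF that(1) \<theta>(2)] by (simp add: umors_at_def umor_conj_def)
    ultimately show "C \<in> umor_classes_at G U (conj_set G b P') (conj_set G b K')"
      using umor_class_conj[OF that(1) \<theta>(2)] unfolding umor_classes_at_def by blast
  qed
  show ?thesis
    using le[OF assms] le[OF _ conj_set_sections[OF assms], of "inv a"] assms
    by (simp add: conj_set_inv sections_subset[OF assms(2)])
qed

section \<open>Multiplication by automorphisms\<close>

lemma auto_iff:
  "\<alpha> \<in> auto U \<longleftrightarrow> \<alpha> \<in> iso U U \<and> \<alpha> \<in> extensional (carrier U)"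
  by (auto simp: auto_def Bij_def iso_def)

lemma umor_aut_closed:
  assumes "\<alpha> \<in> auto U" "(P, K, \<theta>) \<in> umors G U"
  shows "umor_aut G \<alpha> (P, K, \<theta>) \<in> umors G U"
proof -
  have "\<alpha> \<circ> \<theta> \<in> iso (quot G P K) U"
    using assms by (auto simp: umors_iff auto_iff intro: iso_set_trans)
  then have "restrict (\<alpha> \<circ> \<theta>) (carrier (quot G P K)) \<in> iso (quot G P K) U"
    using assms(2) by (intro restrict_iso group_quot) (simp_all add: umors_iff)
  then show ?thesis
    using assms by (simp add: umor_aut_def umors_iff compose_def o_def)
qed

lemma umor_aut_id:
  assumes "m \<in> umors G U"
  shows "umor_aut G (\<lambda>u\<in>carrier U. u) m = m"
proof (cases m)
  case (fields P K \<theta>)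
  then show ?thesis
    using assms by (auto simp: umor_aut_def umors_iff iso_def hom_def)
qed

text \<open>Associativity of composition, valid because \<theta> maps into U. Since
  \<open>compose\<close> applies \<beta> first, this is a left action law for
  \<open>AutoGroup U\<close>, hence a right action law for \<open>Aut U\<close>.\<close>

lemma umor_aut_compose:
  assumes "m \<in> umors G U"
  shows "umor_aut G (compose (carrier U) \<alpha> \<beta>) m = umor_aut G \<alpha> (umor_aut G \<beta> m)"
proof (cases m)
  case (fields P K \<theta>)
  have "\<theta> \<in> carrier (quot G P K) \<rightarrow> carrier U"
    using assms by (simp add: fields umors_iff iso_def hom_def)
  then show ?thesis
    by (simp add: fields umor_aut_def compose_assoc)
qed

text \<open>Conjugation changes \<theta> on the side of its domain and \<alpha> on the side of its
  codomain, so the two operations commute.\<close>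

lemma umor_aut_conj:
  assumes "a \<in> carrier G" "m \<in> umors G U"
  shows "umor_aut G \<alpha> (umor_conj G a m) = umor_conj G a (umor_aut G \<alpha> m)"
proof (cases m)
  case (fields P K \<theta>)
  then have sec: "(P, K) \<in> sections G"
    using assms(2) by (simp add: umors_iff)
  have "conj_set G (inv a) C \<in> carrier (quot G P K)"
    if "C \<in> carrier (quot G (conj_set G a P) (conj_set G a K))" for C
    using conj_set_inv_iso[OF assms(1) sec] that by (auto simp: iso_def hom_def)
  then show ?thesis
    using assms(1) sec by (auto simp: fields umor_aut_def umor_conj_eq compose_def)
qed

section \<open>The induced action on orbits\<close>

text \<open>Every representative of the orbit is some \<theta>^a, and (\<theta>^a)\<alpha> =
  (\<theta>\<alpha>)^a has the same class as \<theta>\<alpha>; hence the union in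
  \<open>class_aut\<close> collapses.\<close>

lemma class_aut_umor_class:
  assumes "umor_class G m \<in> E" "m \<in> umors G U" "\<alpha> \<in> auto U"
  shows "class_aut G E \<alpha> (umor_class G m) = umor_class G (umor_aut G \<alpha> m)"
proof -
  have "umor_aut G \<alpha> m \<in> umors G U"
    using assms by (cases m) (simp add: umor_aut_closed)
  then have "umor_class G (umor_aut G \<alpha> (umor_conj G a m)) = umor_class G (umor_aut G \<alpha> m)"
    if "a \<in> carrier G" for a
    using assms(2) that by (simp add: umor_aut_conj umor_class_conj)
  moreover have "umor_class G m = (\<lambda>a. umor_conj G a m) ` carrier G"
    by (auto simp: umor_class_def orbit_def)
  ultimately show ?thesis
    using assms(1) by (auto simp: class_aut_def)
qed

text \<open>Leaving E an arbitrary stable set of orbits serves both the set of all orbits and the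
  set of those at a single section. The action laws are checked on representatives.\<close>

lemma group_action_class_aut:
  assumes "group U" "E \<subseteq> umor_classes G U"
    and closed: "\<And>m \<alpha>. m \<in> umors G U \<Longrightarrow> umor_class G m \<in> E \<Longrightarrow> \<alpha> \<in> auto U \<Longrightarrow>
      umor_class G (umor_aut G \<alpha> m) \<in> E"
  shows "group_action (AutoGroup U) E (class_aut G E)"
proof (rule group_actionI)
  show "group (AutoGroup U)"
    using assms(1) by (rule group.AutoGroup)
  have rep: "\<exists>m\<in>umors G U. C = umor_class G m" if "C \<in> E" for C
    using that assms(2) by (auto simp: umor_classes_def orbits_def umor_class_def)
  have aut: "umor_aut G \<alpha> m \<in> umors G U" if "m \<in> umors G U" "\<alpha> \<in> auto U" for m \<alpha>
    using that by (cases m) (simp add: umor_aut_closed)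
  fix \<alpha> C assume C: "C \<in> E"
  then obtain m where m: "m \<in> umors G U" "C = umor_class G m"
    using rep by blast
  show "class_aut G E \<one>\<^bsub>AutoGroup U\<^esub> C = C"
    using C m group.id_in_auto[OF assms(1)]
    by (simp add: one_AutoGroup class_aut_umor_class umor_aut_id)
  assume "\<alpha> \<in> carrier (AutoGroup U)"
  then have \<alpha>: "\<alpha> \<in> auto U"
    by simp
  show "class_aut G E \<alpha> C \<in> E"
    using C m \<alpha> by (simp add: class_aut_umor_class closed)
  fix \<beta> assume "\<beta> \<in> carrier (AutoGroup U)"
  then have \<beta>: "\<beta> \<in> auto U"
    by simp
  have "compose (carrier U) \<alpha> \<beta> \<in> auto U"
    using group.is_monoid[OF group.AutoGroup[OF assms(1)]] \<alpha> \<beta>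
    by (metis carrier_AutoGroup monoid.m_closed mult_AutoGroup)
  then show "class_aut G E (\<alpha> \<otimes>\<^bsub>AutoGroup U\<^esub> \<beta>) C = class_aut G E \<alpha> (class_aut G E \<beta> C)"
    using C m \<alpha> \<beta>
    by (simp add: mult_AutoGroup class_aut_umor_class[where U = U] umor_aut_compose aut closed)
qed (simp add: class_aut_def)

section \<open>Transitivity at one section\<close>

text \<open>Here \<alpha> is \<theta>^-1 \<theta>', read from left to right, so \<theta>\<alpha> =
  \<theta>'. Besides transitivity, this also serves to recognise the elements of
  \<open>A_umor\<close> as automorphisms.\<close>

lemma iso_quotient_auto:
  assumes "(P, K, \<theta>) \<in> umors G U" "(P, K, \<theta>') \<in> umors G U"
  defines "\<alpha> \<equiv> \<lambda>u\<in>carrier U. \<theta>' (inv_into (carrier (quot G P K)) \<theta> u)"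
  shows "group U \<Longrightarrow> \<alpha> \<in> auto U" and "umor_aut G \<alpha> (P, K, \<theta>) = (P, K, \<theta>')"
proof -
  define Q where "Q = quot G P K"
  have \<theta>: "\<theta> \<in> iso Q U" "\<theta>' \<in> iso Q U" "\<theta>' \<in> extensional (carrier Q)"
    using assms by (simp_all add: umors_iff Q_def)
  have "group Q"
    using assms(1) by (simp add: umors_iff Q_def group_quot)
  then have "\<theta>' \<circ> inv_into (carrier Q) \<theta> \<in> iso U U"
    using \<theta> by (meson group.iso_set_sym iso_set_trans)
  then show "\<alpha> \<in> auto U" if "group U"
    using restrict_iso[OF that] by (fastforce simp: auto_iff \<alpha>_def Q_def o_def)
  have "\<theta> C \<in> carrier U" "inv_into (carrier Q) \<theta> (\<theta> C) = C" if "C \<in> carrier Q" for C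
    using \<theta>(1) that by (auto simp: iso_def hom_def bij_betw_def)
  then have "compose (carrier Q) \<alpha> \<theta> = restrict \<theta>' (carrier Q)"
    unfolding compose_def by (intro restrict_ext) (simp add: \<alpha>_def Q_def)
  then show "umor_aut G \<alpha> (P, K, \<theta>) = (P, K, \<theta>')"
    using \<theta>(3) by (simp add: umor_aut_def Q_def extensional_restrict)
qed

lemma umor_classes_at_eq:
  "umor_classes_at G U P K = {umor_class G (P, K, \<theta>) | \<theta>. (P, K, \<theta>) \<in> umors G U}"
  by (auto simp: umor_classes_at_def umors_at_def)

lemma umor_classes_at_eq_aut:
  assumes "group U" "(P, K, \<theta>) \<in> umors G U"
  shows "umor_classes_at G U P K = {umor_class G (umor_aut G \<alpha> (P, K, \<theta>)) | \<alpha>. \<alpha> \<in> auto U}"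
proof (intro subset_antisym subsetI)
  fix C assume "C \<in> umor_classes_at G U P K"
  then obtain \<theta>' where "C = umor_class G (P, K, \<theta>')" "(P, K, \<theta>') \<in> umors G U"
    by (auto simp: umor_classes_at_eq)
  then show "C \<in> {umor_class G (umor_aut G \<alpha> (P, K, \<theta>)) | \<alpha>. \<alpha> \<in> auto U}"
    using iso_quotient_auto[OF assms(2)] assms(1) by (metis (mono_tags, lifting) mem_Collect_eq)
next
  fix C assume "C \<in> {umor_class G (umor_aut G \<alpha> (P, K, \<theta>)) | \<alpha>. \<alpha> \<in> auto U}"
  then show "C \<in> umor_classes_at G U P K"
    using umor_aut_closed[OF _ assms(2)] by (auto simp: umor_classes_at_eq umor_aut_def)
qed

lemma umor_classes_at_subset: "umor_classes_at G U P K \<subseteq> umor_classes G U"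
  by (auto simp: umor_classes_at_eq umor_classes_def orbits_def umor_class_def)

lemma umors_at_nonempty:
  assumes "(P, K) \<in> iso_sections G U"
  obtains \<theta> where "(P, K, \<theta>) \<in> umors G U"
proof -
  obtain \<theta> where "(P, K) \<in> sections G" "\<theta> \<in> iso (quot G P K) U"
    using assms by (auto simp: iso_sections_def is_iso_def)
  then have "(P, K, restrict \<theta> (carrier (quot G P K))) \<in> umors G U"
    by (simp add: umors_iff restrict_iso group_quot)
  then show ?thesis
    by (rule that)
qed

lemma transitive_umor_classes_at:
  assumes "group U" "(P, K) \<in> iso_sections G U"
  shows "transitive_right_action (Aut U) (umor_classes_at G U P K)
    (class_aut G (umor_classes_at G U P K))"
proof -
  define E where "E = umor_classes_at G U P K"
  \<comment> \<open>Any member of E can serve as base point, with all of E as its orbit; stability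
    and transitivity both follow.\<close>
  have E_aut: "\<exists>\<theta>. C = umor_class G (P, K, \<theta>) \<and> (P, K, \<theta>) \<in> umors G U \<and>
      E = {umor_class G (umor_aut G \<alpha> (P, K, \<theta>)) | \<alpha>. \<alpha> \<in> auto U}" if "C \<in> E" for C
    using that umor_classes_at_eq_aut[OF assms(1)] unfolding E_def umor_classes_at_eq by blast
  have "group_action (AutoGroup U) E (class_aut G E)"
  proof (rule group_action_class_aut[OF assms(1)])
    show "E \<subseteq> umor_classes G U"
      by (simp add: E_def umor_classes_at_subset)
    fix m \<alpha> assume m: "m \<in> umors G U" "umor_class G m \<in> E" and \<alpha>: "\<alpha> \<in> auto U"
    then obtain \<theta> where \<theta>: "umor_class G m = umor_class G (P, K, \<theta>)" "(P, K, \<theta>) \<in> umors G U"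
        and E: "E = {umor_class G (umor_aut G \<alpha> (P, K, \<theta>)) | \<alpha>. \<alpha> \<in> auto U}"
      using E_aut by blast
    \<comment> \<open>The representative m may live on another section conjugate to (P, K). Both
      sides are the value of \<open>class_aut\<close> at the same orbit.\<close>
    have "umor_class G (umor_aut G \<alpha> m) = umor_class G (umor_aut G \<alpha> (P, K, \<theta>))"
      using class_aut_umor_class[OF m(2,1) \<alpha>] class_aut_umor_class[OF _ \<theta>(2) \<alpha>] m(2) \<theta>(1)
      by simp
    then show "umor_class G (umor_aut G \<alpha> m) \<in> E"
      using E \<alpha> by auto
  qed
  moreover have "\<exists>\<alpha>\<in>auto U. class_aut G E \<alpha> C = C'" if C: "C \<in> E" and C': "C' \<in> E" for C C'
  proof -
    obtain \<theta> where \<theta>: "C = umor_class G (P, K, \<theta>)" "(P, K, \<theta>) \<in> umors G U"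
        and E: "E = {umor_class G (umor_aut G \<alpha> (P, K, \<theta>)) | \<alpha>. \<alpha> \<in> auto U}"
      using E_aut[OF C] by blast
    then obtain \<alpha> where "\<alpha> \<in> auto U" "C' = umor_class G (umor_aut G \<alpha> (P, K, \<theta>))"
      using C' by blast
    then show ?thesis
      using C \<theta> by (auto simp: class_aut_umor_class)
  qed
  \<comment> \<open>A transitive set is nonempty by definition here; an isomorphism of P/K with U
    supplies an element.\<close>
  moreover have "E \<noteq> {}"
  proof -
    obtain \<theta> where "(P, K, \<theta>) \<in> umors G U"
      using umors_at_nonempty[OF assms(2)] .
    then show ?thesis
      unfolding E_def umor_classes_at_eq by blast
  qed
  ultimately show ?thesis
    unfolding E_def[symmetric] transitive_right_action_def transitive_action_def
      transitive_action_axioms_def by simp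
qed

section \<open>The group A_\<theta> and its cosets\<close>

text \<open>The normalizer is the stabilizer under S \<mapsto> n S n^-1, which in the right-action
  convention is conjugation by n^-1. That operation is restricted to subsets of G.\<close>

lemma normalizerD:
  assumes "n \<in> normalizer G S" "S \<subseteq> carrier G"
  shows "n \<in> carrier G" "conj_set G (inv n) S = S"
  using assms by (auto simp: normalizer_def stabilizer_def conj_set_def)

text \<open>For h = \<theta>^-1 \<gamma>_n \<theta> one gets \<theta>h = \<gamma>_n \<theta>, which
  is \<theta> conjugated by a = n^-1.\<close>

lemma A_umorE:
  assumes "group U" "(P, K, \<theta>) \<in> umors G U" "h \<in> A_umor G U (P, K, \<theta>)"
  obtains a where "h \<in> auto U" "a \<in> carrier G"
    "umor_aut G h (P, K, \<theta>) = umor_conj G a (P, K, \<theta>)"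
proof -
  define Q where "Q = quot G P K"
  have sec: "(P, K) \<in> sections G" and \<theta>: "\<theta> \<in> iso Q U"
    using assms(2) by (simp_all add: umors_iff Q_def)
  obtain n where n: "n \<in> normalizer G P" "n \<in> normalizer G K"
      and h: "h = (\<lambda>u\<in>carrier U. \<theta> (conj_set G n (inv_into (carrier Q) \<theta> u)))"
    using assms(3) by (auto simp: A_umor_def Q_def)
  note n = normalizerD[OF n(1)] normalizerD[OF n(2)]
  then have nG: "n \<in> carrier G" and PK: "conj_set G (inv n) P = P" "conj_set G (inv n) K = K"
    using sections_subset[OF sec] by auto
  \<comment> \<open>This is \<gamma>_n \<theta>, again with domain P/K because n normalizes P and K.
    Then h is \<theta>^-1 \<theta>', and \<open>iso_quotient_auto\<close> applies.\<close>
  define \<theta>' where "\<theta>' = (\<lambda>C\<in>carrier Q. \<theta> (conj_set G n C))"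
  have conj: "umor_conj G (inv n) (P, K, \<theta>) = (P, K, \<theta>')"
    using nG sec by (simp add: umor_conj_eq PK \<theta>'_def Q_def)
  have \<theta>': "(P, K, \<theta>') \<in> umors G U"
    using umor_conj_closed[OF _ assms(2), of "inv n"] nG by (simp add: conj)
  have "inv_into (carrier Q) \<theta> u \<in> carrier Q" if "u \<in> carrier U" for u
    using \<theta> that by (auto simp: iso_def bij_betw_def intro: inv_into_into)
  then have "h = (\<lambda>u\<in>carrier U. \<theta>' (inv_into (carrier Q) \<theta> u))"
    unfolding h by (intro restrict_ext) (simp add: \<theta>'_def)
  then show ?thesis
    using iso_quotient_auto[OF assms(2) \<theta>'] assms(1) nG conj
    by (intro that[of "inv n"]) (simp_all add: Q_def)
qed

text \<open>With \<theta>h = \<theta>^a one has \<theta>h\<alpha> = (\<theta>^a)\<alpha> =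
  (\<theta>\<alpha>)^a. Thus the class of \<theta>\<alpha> is constant on the right coset of
  \<alpha>.\<close>

lemma umor_class_aut_A_umor:
  assumes "group U" "m \<in> umors G U" "h \<in> A_umor G U m" "\<alpha> \<in> auto U"
  shows "umor_class G (umor_aut G (h \<otimes>\<^bsub>Aut U\<^esub> \<alpha>) m) = umor_class G (umor_aut G \<alpha> m)"
proof (cases m)
  case (fields P K \<theta>)
  obtain a where h: "h \<in> auto U" and a: "a \<in> carrier G" "umor_aut G h m = umor_conj G a m"
    using A_umorE[OF assms(1)] assms(2,3) unfolding fields by blast
  \<comment> \<open>The product of \<open>Aut U\<close> is the opposite one: h acts first.\<close>
  have "h \<otimes>\<^bsub>Aut U\<^esub> \<alpha> = compose (carrier U) \<alpha> h"
    using mult_AutoGroup[OF assms(4) h] by (simp add: Aut_def opp_group_def)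
  moreover have "umor_aut G \<alpha> m \<in> umors G U"
    using assms(2,4) unfolding fields by (rule umor_aut_closed[rotated])
  ultimately show ?thesis
    using assms(2) a by (simp add: umor_aut_compose umor_aut_conj umor_class_conj)
qed

lemma umor_classes_at_eq_transversal:
  assumes "group U" "(P, K, \<theta>) \<in> umors G U"
    and "right_transversal (Aut U) (A_umor G U (P, K, \<theta>)) D"
  shows "umor_classes_at G U P K = {umor_class G (umor_aut G \<alpha> (P, K, \<theta>)) | \<alpha>. \<alpha> \<in> D}"
proof -
  let ?A = "A_umor G U (P, K, \<theta>)"
  have carrier: "carrier (Aut U) = auto U"
    by (simp add: Aut_def opp_group_def)
  have "\<exists>d\<in>D. umor_class G (umor_aut G d (P, K, \<theta>)) = umor_class G (umor_aut G \<alpha> (P, K, \<theta>))"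
    if \<alpha>: "\<alpha> \<in> auto U" for \<alpha>
  proof -
    \<comment> \<open>The transversal meets the coset of \<alpha> in some d = h\<alpha>, and d
      yields the same class as \<alpha>.\<close>
    have "?A #>\<^bsub>Aut U\<^esub> \<alpha> \<in> rcosets\<^bsub>Aut U\<^esub> ?A"
      using \<alpha> by (auto simp: RCOSETS_def carrier)
    then obtain d where "d \<in> D" "d \<in> ?A #>\<^bsub>Aut U\<^esub> \<alpha>"
      using assms(3) unfolding right_transversal_def by blast
    moreover from this obtain h where "h \<in> ?A" "d = h \<otimes>\<^bsub>Aut U\<^esub> \<alpha>"
      by (auto simp: r_coset_def)
    ultimately show ?thesis
      using umor_class_aut_A_umor[OF assms(1,2)] \<alpha> by blast
  qed
  moreover have "D \<subseteq> auto U"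
    using assms(3) by (simp add: right_transversal_def carrier)
  ultimately show ?thesis
    unfolding umor_classes_at_eq_aut[OF assms(1,2)] by (auto 0 3) metis
qed

section \<open>All orbits and their decomposition by classes of sections\<close>

lemma right_action_umor_classes:
  assumes "group U"
  shows "right_action (Aut U) (umor_classes G U) (class_aut G (umor_classes G U))"
proof -
  have "umor_class G (umor_aut G \<alpha> m) \<in> umor_classes G U"
    if "m \<in> umors G U" "\<alpha> \<in> auto U" for m \<alpha>
  proof -
    have "umor_aut G \<alpha> m \<in> umors G U"
      using that by (cases m) (simp add: umor_aut_closed)
    then show ?thesis
      unfolding umor_classes_def orbits_def umor_class_def by blast
  qed
  then show ?thesis
    unfolding right_action_def opp_group_Aut
    by (intro group_action_class_aut[OF assms]) auto
qed

text \<open>Representatives of the common orbit on the two sections are conjugate by some a, and the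
  same a conjugates the sections because a morphism carries its section.\<close>

lemma section_class_eq_if_umor_classes_at_meet:
  assumes "C \<in> umor_classes_at G U P K" "C \<in> umor_classes_at G U P' K'"
  shows "section_class G (P, K) = section_class G (P', K')"
proof -
  obtain \<theta> \<theta>' where C: "C = umor_class G (P, K, \<theta>)" "C = umor_class G (P', K', \<theta>')"
      and \<theta>: "(P, K, \<theta>) \<in> umors G U" "(P', K', \<theta>') \<in> umors G U"
    using assms by (auto simp: umor_classes_at_eq)
  then obtain a where a: "a \<in> carrier G" "(P', K', \<theta>') = umor_conj G a (P, K, \<theta>)"
    using umor_class_eqE by metis
  moreover have "(P, K) \<in> sections G"
    using \<theta>(1) by (simp add: umors_iff)
  ultimately show ?thesis
    by (simp add: umor_conj_def section_class_conj)
qed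

lemma umor_classes_decomposition:
  shows "(P, K) \<in> iso_sections G U \<Longrightarrow>
      umor_classes_over G U (section_class G (P, K)) = umor_classes_at G U P K"
    and "disjoint_family_on (umor_classes_over G U) (section_classes G U)"
    and "umor_classes G U = (\<Union>c\<in>section_classes G U. umor_classes_over G U c)"
proof -
  have classes: "section_classes G U = section_class G ` iso_sections G U"
    by (auto simp: section_classes_def orbits_def section_class_def)
  show F: "umor_classes_over G U (section_class G (P, K)) = umor_classes_at G U P K"
    if "(P, K) \<in> iso_sections G U" for P K
  proof -
    have "section_class G (P, K) = (\<lambda>a. (conj_set G a P, conj_set G a K)) ` carrier G"
      by (auto simp: section_class_def orbit_def section_conj_def)
    moreover have "(P, K) \<in> sections G"
      using that by (simp add: iso_sections_def)
    ultimately show ?thesis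
      \<comment> \<open>All members of the union agree; the unit shows that the index set is
        nonempty.\<close>
      using one_closed by (auto simp: umor_classes_over_def umor_classes_at_conj)
  qed
  have F_class: "\<exists>P K. c = section_class G (P, K) \<and>
      umor_classes_over G U c = umor_classes_at G U P K"
    if c: "c \<in> section_classes G U" for c
  proof -
    obtain P K where "(P, K) \<in> iso_sections G U" "c = section_class G (P, K)"
      using c by (auto simp: classes)
    then show ?thesis
      using F by auto
  qed
  have "umor_classes_over G U c \<inter> umor_classes_over G U c' = {}"
    if c: "c \<in> section_classes G U" "c' \<in> section_classes G U" "c \<noteq> c'" for c c'
    using F_class[OF c(1)] F_class[OF c(2)] c(3)
      section_class_eq_if_umor_classes_at_meet
    by (metis disjoint_iff)
  then show "disjoint_family_on (umor_classes_over G U) (section_classes G U)"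
    by (simp add: disjoint_family_on_def)
  \<comment> \<open>The union is first taken over single sections and then regrouped by class;
    conjugate sections contribute the same set.\<close>
  have "umor_classes G U = (\<Union>(P, K)\<in>iso_sections G U. umor_classes_at G U P K)"
  proof (intro subset_antisym subsetI)
    fix C assume "C \<in> umor_classes G U"
    then obtain P K \<theta> where "(P, K, \<theta>) \<in> umors G U" "C = umor_class G (P, K, \<theta>)"
      by (auto simp: umor_classes_def orbits_def umor_class_def)
    moreover from this have "(P, K) \<in> iso_sections G U"
      by (simp add: umors_def)
    ultimately show "C \<in> (\<Union>(P, K)\<in>iso_sections G U. umor_classes_at G U P K)"
      unfolding umor_classes_at_eq by blast
  qed (use umor_classes_at_subset in blast)
  also have "\<dots> = (\<Union>(P, K)\<in>iso_sections G U. umor_classes_over G U (section_class G (P, K)))"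
    using F by (intro SUP_cong) auto
  also have "\<dots> = (\<Union>c\<in>section_classes G U. umor_classes_over G U c)"
    unfolding classes by (simp add: case_prod_beta)
  finally show "umor_classes G U = (\<Union>c\<in>section_classes G U. umor_classes_over G U c)" .
qed

end

theorem proposition4p2:
  fixes G :: "('a, 'm) monoid_scheme" and U :: "('b, 'n) monoid_scheme"
  assumes "group G" and "finite (carrier G)"
    and "group U" and "finite (carrier U)"
    and "\<exists>P K. (P, K) \<in> sections G \<and> quot G P K \<cong> U"
  shows "right_action (Aut U) (umor_classes G U) (class_aut G (umor_classes G U)) \<and>
    (\<exists>F. (\<forall>(P, K) \<in> iso_sections G U. F (section_class G (P, K)) = umor_classes_at G U P K) \<and>
         (\<forall>c \<in> section_classes G U. transitive_right_action (Aut U) (F c) (class_aut G (F c))) \<and>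
         disjoint_family_on F (section_classes G U) \<and>
         umor_classes G U = (\<Union>c \<in> section_classes G U. F c)) \<and>
    (\<forall>P K \<theta> D. (P, K, \<theta>) \<in> umors G U \<longrightarrow>
       right_transversal (Aut U) (A_umor G U (P, K, \<theta>)) D \<longrightarrow>
       umor_classes_at G U P K = {umor_class G (umor_aut G \<alpha> (P, K, \<theta>)) | \<alpha>. \<alpha> \<in> D})"
proof (intro conjI allI impI)
  interpret group G by fact
  show "right_action (Aut U) (umor_classes G U) (class_aut G (umor_classes G U))"
    using assms(3) by (rule right_action_umor_classes)
  let ?F = "umor_classes_over G U"
  note F = umor_classes_decomposition[where U = U]
  have "transitive_right_action (Aut U) (?F c) (class_aut G (?F c))"
    if c: "c \<in> section_classes G U" for c
  proof -
    \<comment> \<open>A representative section turns the member of the family at c into the set of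
      classes at (P, K), which is transitive.\<close>
    obtain P K where "(P, K) \<in> iso_sections G U" "c = section_class G (P, K)"
      using c by (auto simp: section_classes_def orbits_def section_class_def)
    then show ?thesis
      using transitive_umor_classes_at[OF assms(3)] F(1) by metis
  qed
  then show "\<exists>F. (\<forall>(P, K) \<in> iso_sections G U.
           F (section_class G (P, K)) = umor_classes_at G U P K) \<and>
         (\<forall>c \<in> section_classes G U. transitive_right_action (Aut U) (F c) (class_aut G (F c))) \<and>
         disjoint_family_on F (section_classes G U) \<and>
         umor_classes G U = (\<Union>c \<in> section_classes G U. F c)"
    using F by (intro exI[of _ ?F]) auto
  fix P K \<theta> D
  assume "(P, K, \<theta>) \<in> umors G U" "right_transversal (Aut U) (A_umor G U (P, K, \<theta>)) D"
  then show "umor_classes_at G U P K = {umor_class G (umor_aut G \<alpha> (P, K, \<theta>)) | \<alpha>. \<alpha> \<in> D}"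
    by (rule umor_classes_at_eq_transversal[OF assms(3)])
qed

end
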